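(* Let $G = G_2(\alpha,2,1,0,-)$ be a metacyclic $2$-group of negative type (with $\beta=2$, $\epsilon=1$, $\delta=0$). Then $\eta(G)=\alpha+2$.
   Context: For a finite group $G$, a maximal cyclic subgroup is a cyclic subgroup not properly contained in any other cyclic subgroup, and $\eta(G)$ is the number of conjugacy classes of maximal cyclic subgroups of $G$. Write $x^y = y^{-1}xy$. For integers $\alpha,\beta>0$, $\delta\ge 0$, $\epsilon\in\{0,1\}$ with $\delta\le\beta$, $\alpha-\delta\ge 2$ and $\delta+\epsilon\le\alpha$ (and $\beta\ge\delta+1$ when $\epsilon=1$), the metacyclic $2$-group of negative type is $$G_2(\alpha,\beta,\epsilon,\delta,-)=\langle x,y \mid x^{2^\alpha}=1,\ y^{2^\beta}=x^{2^{\alpha-\epsilon}},\ x^y=x^{r}\rangle,\quad r=2^{\alpha-\delta}-1.$$ It has order $2^{\alpha+\beta}$. *)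

theory Defs
  imports "HOL-Algebra.Elementary_Groups"
begin

section \<open>Groups given by generators and relations\<close>

text \<open>A word over \<open>'g\<close> is a list of letters; \<open>(a, True)\<close> stands for the generator \<open>a\<close> and
  \<open>(a, False)\<close> for its formal inverse. A relation \<open>u = v\<close> is the pair of words \<open>(u, v)\<close>.\<close>

type_synonym 'g word = "('g \<times> bool) list"

inductive word_eq :: "('g word \<times> 'g word) set \<Rightarrow> 'g word \<Rightarrow> 'g word \<Rightarrow> bool"
  for R :: "('g word \<times> 'g word) set"
where
  rel: "(u, v) \<in> R \<Longrightarrow> word_eq R u v"
| cancel: "word_eq R [(a, b), (a, \<not> b)] []"
| refl: "word_eq R u u"
| sym: "word_eq R u v \<Longrightarrow> word_eq R v u"
| trans: "word_eq R u v \<Longrightarrow> word_eq R v w \<Longrightarrow> word_eq R u w"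
| append: "word_eq R u u' \<Longrightarrow> word_eq R v v' \<Longrightarrow> word_eq R (u @ v) (u' @ v')"

definition word_class :: "('g word \<times> 'g word) set \<Rightarrow> 'g word \<Rightarrow> 'g word set"
  where "word_class R u = {v. word_eq R u v}"

definition presented_group :: "('g word \<times> 'g word) set \<Rightarrow> 'g word set monoid"
  where "presented_group R =
    \<lparr>carrier = range (word_class R),
     monoid.mult = (\<lambda>A B. {w. \<exists>u\<in>A. \<exists>v\<in>B. word_eq R (u @ v) w}),
     one = word_class R []\<rparr>"

lemma word_class_eq_iff: "word_class R u = word_class R v \<longleftrightarrow> word_eq R u v"
  unfolding word_class_def set_eq_iff mem_Collect_eq
  by (meson word_eq.refl word_eq.sym word_eq.trans)

lemma presented_group_simps:
  "carrier (presented_group R) = range (word_class R)"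
  "\<one>\<^bsub>presented_group R\<^esub> = word_class R []"
  "word_class R u \<otimes>\<^bsub>presented_group R\<^esub> word_class R v = word_class R (u @ v)"
proof -
  show "word_class R u \<otimes>\<^bsub>presented_group R\<^esub> word_class R v = word_class R (u @ v)"
    unfolding presented_group_def word_class_def
    by (auto intro: word_eq.append word_eq.refl word_eq.trans)
qed (simp_all add: presented_group_def)

definition word_inv :: "'g word \<Rightarrow> 'g word"
  where "word_inv u = rev (map (\<lambda>(a, b). (a, \<not> b)) u)"

lemma word_eq_inv: "word_eq R (word_inv u @ u) []"
proof (induction u)
  case Nil
  show ?case by (simp add: word_inv_def word_eq.refl)
next
  case (Cons p u)
  obtain a b where p: "p = (a, b)" by (cases p)
  have "word_eq R [(a, \<not> b), (a, b)] []"
    using word_eq.cancel[of R a "\<not> b"] by simp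
  then have "word_eq R ((word_inv u @ [(a, \<not> b), (a, b)]) @ u) ((word_inv u @ []) @ u)"
    by (intro word_eq.append word_eq.refl)
  with Cons.IH show ?case
    by (auto simp: word_inv_def p intro: word_eq.trans)
qed

lemma group_presented_group: "group (presented_group R)"
proof (rule groupI)
  fix A assume "A \<in> carrier (presented_group R)"
  then obtain u where "A = word_class R u" by (auto simp: presented_group_simps)
  then show "\<exists>B\<in>carrier (presented_group R).
      B \<otimes>\<^bsub>presented_group R\<^esub> A = \<one>\<^bsub>presented_group R\<^esub>"
    by (intro bexI[of _ "word_class R (word_inv u)"])
      (auto simp: presented_group_simps word_class_eq_iff word_eq_inv)
qed (auto simp: presented_group_simps)

text \<open>The universal property of the presentation.\<close>

definition word_eval :: "('h, 'm) monoid_scheme \<Rightarrow> ('g \<Rightarrow> 'h) \<Rightarrow> 'g word \<Rightarrow> 'h"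
  where "word_eval H f u =
    foldr (\<lambda>(a, b) h. (if b then f a else inv\<^bsub>H\<^esub> f a) \<otimes>\<^bsub>H\<^esub> h) u \<one>\<^bsub>H\<^esub>"

lemma presented_group_universal:
  assumes "group H" and f: "\<And>a. f a \<in> carrier H"
    and R: "\<And>u v. (u, v) \<in> R \<Longrightarrow> word_eval H f u = word_eval H f v"
  shows "\<exists>h \<in> hom (presented_group R) H. \<forall>a. h (word_class R [(a, True)]) = f a"
proof -
  interpret H: group H by fact
  have cl: "word_eval H f u \<in> carrier H" for u
    by (induction u) (auto simp: word_eval_def f)
  have app: "word_eval H f (u @ v) = word_eval H f u \<otimes>\<^bsub>H\<^esub> word_eval H f v" for u v
  proof (induction u)
    case Nil
    show ?case using cl[of v] by (simp add: word_eval_def)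
  next
    case (Cons p u)
    then show ?case
      using cl[of u] cl[of v] f by (cases p) (auto simp: word_eval_def H.m_assoc)
  qed
  have eq: "word_eval H f u = word_eval H f v" if "word_eq R u v" for u v
    using that
  proof induction
    case (cancel a b)
    show ?case by (simp add: word_eval_def f)
  qed (simp_all add: R app)
  define h where "h A = word_eval H f (SOME u. A = word_class R u)" for A
  have h: "h (word_class R u) = word_eval H f u" for u
  proof -
    have "word_class R u = word_class R (SOME v. word_class R u = word_class R v)"
      by (rule someI) (rule HOL.refl)
    then show ?thesis
      unfolding h_def by (metis eq word_class_eq_iff)
  qed
  have "h \<in> hom (presented_group R) H"
    by (auto simp: hom_def presented_group_simps h cl app)
  moreover have "h (word_class R [(a, True)]) = f a" for a
    by (simp add: h) (simp add: word_eval_def f)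
  ultimately show ?thesis by blast
qed


section \<open>Metacyclic 2-groups of negative type\<close>

datatype gen = X | Y

definition neg_type_params :: "nat \<Rightarrow> nat \<Rightarrow> nat \<Rightarrow> nat \<Rightarrow> bool"
  where "neg_type_params \<alpha> \<beta> \<epsilon> \<delta> \<longleftrightarrow>
    \<alpha> > 0 \<and> \<beta> > 0 \<and> \<epsilon> \<in> {0, 1} \<and> \<delta> \<le> \<beta> \<and> int \<alpha> - int \<delta> \<ge> 2 \<and> \<delta> + \<epsilon> \<le> \<alpha> \<and>
    (\<epsilon> = 1 \<longrightarrow> \<beta> \<ge> \<delta> + 1)"

text \<open>The three relations are \<open>x ^ (2 ^ \<alpha>) = 1\<close>, \<open>y ^ (2 ^ \<beta>) = x ^ (2 ^ (\<alpha> - \<epsilon>))\<close> and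
  \<open>y\<inverse> x y = x ^ (2 ^ (\<alpha> - \<delta>) - 1)\<close>. Under \<open>neg_type_params\<close> none of the
  natural-number subtractions truncates.\<close>

definition G2_neg_relations :: "nat \<Rightarrow> nat \<Rightarrow> nat \<Rightarrow> nat \<Rightarrow> (gen word \<times> gen word) set"
  where "G2_neg_relations \<alpha> \<beta> \<epsilon> \<delta> =
    {(replicate (2 ^ \<alpha>) (X, True), []),
     (replicate (2 ^ \<beta>) (Y, True), replicate (2 ^ (\<alpha> - \<epsilon>)) (X, True)),
     ([(Y, False), (X, True), (Y, True)], replicate (2 ^ (\<alpha> - \<delta>) - 1) (X, True))}"

definition G2_neg :: "nat \<Rightarrow> nat \<Rightarrow> nat \<Rightarrow> nat \<Rightarrow> gen word set monoid"
  where "G2_neg \<alpha> \<beta> \<epsilon> \<delta> = presented_group (G2_neg_relations \<alpha> \<beta> \<epsilon> \<delta>)"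


section \<open>Conjugacy classes of maximal cyclic subgroups\<close>

definition cyclic_subgroup :: "('a, 'b) monoid_scheme \<Rightarrow> 'a set \<Rightarrow> bool"
  where "cyclic_subgroup G C \<longleftrightarrow> subgroup C G \<and> cyclic_group (G\<lparr>carrier := C\<rparr>)"

definition maximal_cyclic_subgroups :: "('a, 'b) monoid_scheme \<Rightarrow> 'a set set"
  where "maximal_cyclic_subgroups G =
    {C. cyclic_subgroup G C \<and> \<not> (\<exists>D. cyclic_subgroup G D \<and> C \<subset> D)}"

definition conjugate_subgroup :: "('a, 'b) monoid_scheme \<Rightarrow> 'a set \<Rightarrow> 'a \<Rightarrow> 'a set"
  where "conjugate_subgroup G C g = (\<lambda>c. inv\<^bsub>G\<^esub> g \<otimes>\<^bsub>G\<^esub> c \<otimes>\<^bsub>G\<^esub> g) ` C"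

definition conjugacy_rel :: "('a, 'b) monoid_scheme \<Rightarrow> ('a set \<times> 'a set) set"
  where "conjugacy_rel G = {(C, D). \<exists>g\<in>carrier G. D = conjugate_subgroup G C g}"

text \<open>Only meaningful for finite \<open>G\<close>: \<open>card\<close> is \<open>0\<close> when there are infinitely many classes.\<close>

definition eta :: "('a, 'b) monoid_scheme \<Rightarrow> nat"
  where "eta G = card (maximal_cyclic_subgroups G // conjugacy_rel G)"

end

theory Submission
  imports Defs "HOL-Computational_Algebra.Primes"
begin

text \<open>
  Put \<open>h = 2 ^ (\<alpha> - 2)\<close>. The group consists of the elements \<open>x\<^sup>i y\<^sup>j\<close>,
  where \<open>y\<close> inverts \<open>x\<close>, \<open>x\<close> has order \<open>4 * h\<close> and
  \<open>y\<^sup>4 = x\<^bsup>2h\<^esup>\<close>.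

  Outside the subgroup \<open>\<langle>x, y\<^sup>2\<rangle>\<close> of index 2, the elements
  \<open>x\<^sup>i y\<close> have order 8 and square \<open>y\<^sup>2\<close>. Conjugation changes \<open>i\<close>
  only by even amounts and sign, so these elements contribute two classes, those of
  \<open>\<langle>y\<rangle>\<close> and \<open>\<langle>xy\<rangle>\<close>.

  The subgroup itself is the direct product of \<open>\<langle>x\<rangle>\<close> with
  \<open>\<langle>t\<rangle>\<close>, where \<open>t = x\<^bsup>-h\<^esup> y\<^sup>2\<close> is an involution. Its
  maximal cyclic subgroups are \<open>\<langle>x\<rangle>\<close> and the groups generated by
  \<open>x\<^sup>w t\<close> for \<open>w = 2 ^ v\<close> with \<open>v \<le> \<alpha>\<close>, because only odd powers
  of \<open>x\<^sup>w t\<close> lie outside \<open>\<langle>x\<rangle>\<close>. Of these \<open>\<alpha> + 2\<close> groups,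
  the one with \<open>w = h\<close> is \<open>\<langle>y\<^sup>2\<rangle>\<close> and thus not maximal in the whole
  group. Conjugation by \<open>y\<close> takes \<open>x\<^sup>w t\<close> to \<open>x\<^bsup>2h-w\<^esup> t\<close>, which
  preserves the valuation of \<open>w\<close> except that it exchanges \<open>w = 2 * h\<close> with
  \<open>w = 4 * h\<close>. This leaves \<open>\<alpha>\<close> classes, and \<open>\<alpha> + 2\<close> in total.

  Two facts make this rigorous. The presentation must define a group in which
  the pairs \<open>(i, j)\<close> are identified only as described; here \<open>G2_neg_coordinatized\<close> reads
  off exponents from words and shows that they are invariant modulo the relations. Then
  \<open>eta_eq_card_transversal\<close> reduces the count to a list of representatives whose conjugates
  generate cyclic subgroups that cover the group, none of which contains another representative;
  \<open>representatives_cover\<close> and \<open>representatives_separated\<close> are congruences between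
  integers.
\<close>

section \<open>Counting maximal cyclic subgroups up to conjugacy\<close>

lemma (in group) conj_hom:
  assumes "g \<in> carrier G"
  shows "(\<lambda>a. inv g \<otimes> a \<otimes> g) \<in> hom G G"
proof (rule homI)
  fix a b assume "a \<in> carrier G" "b \<in> carrier G"
  then show "inv g \<otimes> (a \<otimes> b) \<otimes> g = (inv g \<otimes> a \<otimes> g) \<otimes> (inv g \<otimes> b \<otimes> g)"
    using assms by (simp add: m_assoc inv_solve_left' flip: m_assoc[of g "inv g"])
qed (use assms in simp)

lemma (in group) conj_int_pow:
  assumes "g \<in> carrier G" "a \<in> carrier G"
  shows "(inv g \<otimes> a \<otimes> g) [^] (k::int) = inv g \<otimes> a [^] k \<otimes> g"
  using hom_int_pow[OF conj_hom[OF assms(1)] assms(2) is_group is_group] by simp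

lemma (in group) conjugate_generate:
  assumes "g \<in> carrier G" "a \<in> carrier G"
  shows "conjugate_subgroup G (generate G {a}) g = generate G {inv g \<otimes> a \<otimes> g}"
  using assms by (auto simp: conjugate_subgroup_def generate_pow conj_int_pow)

lemma (in group) conjugate_subgroup_one:
  assumes "C \<subseteq> carrier G"
  shows "conjugate_subgroup G C \<one> = C"
  using assms by (force simp: conjugate_subgroup_def image_iff)

lemma (in group) conjugate_subgroup_mult:
  assumes "C \<subseteq> carrier G" "g \<in> carrier G" "k \<in> carrier G"
  shows "conjugate_subgroup G (conjugate_subgroup G C g) k = conjugate_subgroup G C (g \<otimes> k)"
  unfolding conjugate_subgroup_def image_image
  using assms by (intro image_cong) (auto simp: inv_mult_group m_assoc subset_iff)

lemma (in group) cyclic_subgroup_iff: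
  "cyclic_subgroup G C \<longleftrightarrow> (\<exists>c\<in>carrier G. C = generate G {c})"
proof
  assume "cyclic_subgroup G C"
  then have C: "subgroup C G" and cyc: "cyclic_group (G\<lparr>carrier := C\<rparr>)"
    by (auto simp: cyclic_subgroup_def)
  interpret C: group "G\<lparr>carrier := C\<rparr>"
    using C by (rule subgroup_imp_group)
  obtain c where c: "c \<in> C" "C = range (\<lambda>n::int. c [^]\<^bsub>G\<lparr>carrier := C\<rparr>\<^esub> n)"
    using cyc by (auto simp: C.cyclic_group)
  then have "C = generate G {c}"
    using subgroup.mem_carrier[OF C] by (auto simp: generate_pow int_pow_consistent[OF C, symmetric])
  with c show "\<exists>c\<in>carrier G. C = generate G {c}"
    using subgroup.mem_carrier[OF C] by blast
next
  assume "\<exists>c\<in>carrier G. C = generate G {c}"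
  then obtain c where c: "c \<in> carrier G" "C = generate G {c}" by blast
  then have C: "subgroup C G" by (simp add: generate_is_subgroup)
  interpret C: group "G\<lparr>carrier := C\<rparr>"
    using C by (rule subgroup_imp_group)
  have "c \<in> C" using c by (simp add: generate.incl)
  have "C = range (\<lambda>n::int. c [^] n)" using c by (auto simp: generate_pow)
  then have "C = range (\<lambda>n::int. c [^]\<^bsub>G\<lparr>carrier := C\<rparr>\<^esub> n)"
    using int_pow_consistent[OF C \<open>c \<in> C\<close>] by simp
  with C \<open>c \<in> C\<close> show "cyclic_subgroup G C"
    by (auto simp: cyclic_subgroup_def C.cyclic_group)
qed

text \<open>A criterion that avoids testing subgroups for maximality one by one. If the conjugates of
  the subgroups \<open>\<langle>r\<rangle>\<close> cover the group, then every cyclic subgroup lies in one of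
  them. If moreover no representative lies in a conjugate of another \<open>\<langle>r\<rangle>\<close>, each
  \<open>\<langle>r\<rangle>\<close> is itself maximal: a cyclic group above it lies in a conjugate of some
  \<open>\<langle>s\<rangle>\<close>, which forces \<open>s = r\<close>, and a conjugate of
  \<open>\<langle>r\<rangle>\<close> has no more elements than \<open>\<langle>r\<rangle>\<close>.\<close>

lemma (in group) eta_eq_card_transversal:
  assumes fin: "finite (carrier G)" and R: "R \<subseteq> carrier G"
    and covers: "\<And>a. a \<in> carrier G \<Longrightarrow>
      \<exists>r\<in>R. \<exists>g\<in>carrier G. \<exists>k::int. a = inv g \<otimes> r [^] k \<otimes> g"
    and separated: "\<And>r s g k. r \<in> R \<Longrightarrow> s \<in> R \<Longrightarrow> g \<in> carrier G \<Longrightarrow>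
      s = inv g \<otimes> r [^] (k::int) \<otimes> g \<Longrightarrow> s = r"
  shows "eta G = card R"
proof -
  let ?M = "maximal_cyclic_subgroups G" and ?E = "conjugacy_rel G"
  let ?c = "\<lambda>r g. generate G {inv g \<otimes> r \<otimes> g}"
  have gen_sub: "generate G {a} \<subseteq> carrier G" if "a \<in> carrier G" for a
    using that by (simp add: generate_incl)
  have mem: "a \<in> ?c r g \<longleftrightarrow> (\<exists>k::int. a = inv g \<otimes> r [^] k \<otimes> g)"
    if "r \<in> carrier G" "g \<in> carrier G" for a r g
    using that by (auto simp: generate_pow conj_int_pow)
  have gen_least: "generate G {a} \<subseteq> ?c r g" if "a \<in> ?c r g" "r \<in> carrier G" "g \<in> carrier G" for a r g
    using that by (intro generate_subgroup_incl generate_is_subgroup) auto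
  have one: "?c r \<one> = generate G {r}" if "r \<in> carrier G" for r
    using that by simp
  have above: "\<exists>r\<in>R. \<exists>g\<in>carrier G. C \<subseteq> ?c r g" if "cyclic_subgroup G C" for C
  proof -
    obtain a where a: "a \<in> carrier G" "C = generate G {a}"
      using \<open>cyclic_subgroup G C\<close> by (auto simp: cyclic_subgroup_iff)
    obtain r g where "r \<in> R" "g \<in> carrier G" "a \<in> ?c r g"
      using covers[OF a(1)] mem R by blast
    with a R gen_least show ?thesis by blast
  qed
  have sep: "s = r" if "r \<in> R" "s \<in> R" "g \<in> carrier G" "generate G {s} \<subseteq> ?c r g" for r s g
  proof -
    have "s \<in> ?c r g" using that(4) generate.incl[of s "{s}" G] by blast
    then show ?thesis using that separated R by (auto simp: mem subset_iff)
  qed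
  have maximal: "generate G {r} \<in> ?M" if r: "r \<in> R" for r
  proof -
    have False if D: "cyclic_subgroup G D" "generate G {r} \<subset> D" for D
    proof -
      obtain s g where s: "s \<in> R" "g \<in> carrier G" "D \<subseteq> ?c s g" using above[OF D(1)] by blast
      with D(2) sep[OF s(1) r s(2)] have "r = s" by blast
      have fin_s: "finite (generate G {s})"
        using finite_subset[OF gen_sub fin] s R by blast
      have "?c s g = (\<lambda>c. inv g \<otimes> c \<otimes> g) ` generate G {s}"
        using conjugate_generate[of g s] s R by (auto simp: conjugate_subgroup_def)
      then have "card (?c s g) \<le> card (generate G {s})" "finite (?c s g)"
        using fin_s by (simp_all add: card_image_le)
      moreover have "generate G {s} \<subset> ?c s g" using D(2) s(3) \<open>r = s\<close> by blast
      ultimately show False using psubset_card_mono[of "?c s g" "generate G {s}"] by simp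
    qed
    moreover have "cyclic_subgroup G (generate G {r})"
      using r R by (auto simp: cyclic_subgroup_iff)
    ultimately show ?thesis by (auto simp: maximal_cyclic_subgroups_def)
  qed
  have cls: "?E `` {C} = (\<lambda>g. conjugate_subgroup G C g) ` carrier G" for C
    by (auto simp: conjugacy_rel_def)
  have "bij_betw (\<lambda>r. ?E `` {generate G {r}}) R (?M // ?E)"
    unfolding bij_betw_def
  proof
    show "inj_on (\<lambda>r. ?E `` {generate G {r}}) R"
    proof (rule inj_onI)
      fix r s assume rs: "r \<in> R" "s \<in> R" "?E `` {generate G {r}} = ?E `` {generate G {s}}"
      have "generate G {s} \<in> ?E `` {generate G {s}}"
        unfolding cls using conjugate_subgroup_one[OF gen_sub, of s] rs(2) R
        by (auto simp: image_iff intro!: bexI[of _ \<one>])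
      then have "generate G {s} \<in> ?E `` {generate G {r}}" by (simp only: rs(3))
      then obtain g where g: "g \<in> carrier G" "generate G {s} = conjugate_subgroup G (generate G {r}) g"
        unfolding cls by (rule imageE)
      moreover have "r \<in> carrier G" using rs(1) R by (rule rev_subsetD)
      ultimately have "generate G {s} = ?c r g" by (simp add: conjugate_generate)
      then show "r = s" using sep[OF rs(1,2) g(1)] by simp
    qed
    show "(\<lambda>r. ?E `` {generate G {r}}) ` R = ?M // ?E"
    proof (intro equalityI subsetI)
      fix Q assume "Q \<in> ?M // ?E"
      then obtain C where C: "C \<in> ?M" "Q = ?E `` {C}" by (auto simp: quotient_def)
      then obtain r g where rg: "r \<in> R" "g \<in> carrier G" "C \<subseteq> ?c r g"
        using above[of C] by (auto simp: maximal_cyclic_subgroups_def)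
      then have r: "r \<in> carrier G" using R by blast
      have "cyclic_subgroup G (?c r g)" using r rg(2) by (auto simp: cyclic_subgroup_iff)
      with C(1) rg(3) have "C = ?c r g" by (auto simp: maximal_cyclic_subgroups_def)
      then have Cg: "C = conjugate_subgroup G (generate G {r}) g"
        using conjugate_generate r rg(2) by simp
      have "Q = (\<lambda>k. conjugate_subgroup G (generate G {r}) (g \<otimes> k)) ` carrier G"
        unfolding C(2) cls Cg
        using conjugate_subgroup_mult[OF gen_sub[OF r] rg(2)] by (intro image_cong) auto
      also have "\<dots> = conjugate_subgroup G (generate G {r}) ` ((\<lambda>k. g \<otimes> k) ` carrier G)"
        by (simp add: image_image)
      also have "(\<lambda>k. g \<otimes> k) ` carrier G = carrier G"
        using rg(2) by (rule surj_const_mult)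
      finally have "Q = ?E `` {generate G {r}}" by (simp add: cls)
      with rg(1) show "Q \<in> (\<lambda>r. ?E `` {generate G {r}}) ` R" by blast
    qed (use maximal in \<open>auto simp: quotient_def\<close>)
  qed
  then show ?thesis by (simp add: eta_def bij_betw_same_card)
qed

section \<open>Exponent pairs and their congruence\<close>

definition parity_sign :: "int \<Rightarrow> int"
  where "parity_sign j = (if even j then 1 else -1)"

lemma parity_sign_add: "parity_sign (i + j) = parity_sign i * parity_sign j"
  by (simp add: parity_sign_def)

text \<open>Multiplication in the semidirect product of \<open>\<int>\<close> by \<open>\<int>\<close>
  in which a generator of the second factor acts on the first by negation. The pair
  \<open>(i, j)\<close> stands for \<open>x\<^sup>i y\<^sup>j\<close>.\<close>

fun twisted_mult :: "int \<times> int \<Rightarrow> int \<times> int \<Rightarrow> int \<times> int"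
  where "twisted_mult (i, j) (k, l) = (i + parity_sign j * k, j + l)"

text \<open>Congruence modulo the normal subgroup generated by \<open>(4 * h, 0)\<close> and
  \<open>(- 2 * h, 4)\<close>, that is, modulo the relations \<open>x\<^bsup>4h\<^esup> = 1\<close> and
  \<open>y\<^sup>4 = x\<^bsup>2h\<^esup>\<close>. With \<open>h = 2 ^ (\<alpha> - 2)\<close> these are two of the
  defining relations; the third is built into the multiplication.\<close>

definition same_element :: "int \<Rightarrow> int \<times> int \<Rightarrow> int \<times> int \<Rightarrow> bool"
  where "same_element h p q \<longleftrightarrow>
    (\<exists>m. snd p - snd q = 4 * m \<and> 4 * h dvd fst p - fst q + 2 * h * m)"

fun letter_exponents :: "gen \<times> bool \<Rightarrow> int \<times> int"
  where "letter_exponents (X, b) = (if b then 1 else -1, 0)"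
  | "letter_exponents (Y, b) = (0, if b then 1 else -1)"

definition exponents :: "gen word \<Rightarrow> int \<times> int"
  where "exponents u = foldr (\<lambda>c. twisted_mult (letter_exponents c)) u (0, 0)"

lemma exponents_Nil: "exponents [] = (0, 0)"
  and exponents_Cons: "exponents (c # u) = twisted_mult (letter_exponents c) (exponents u)"
  by (simp_all add: exponents_def)

lemma twisted_mult_assoc: "twisted_mult (twisted_mult p q) r = twisted_mult p (twisted_mult q r)"
  by (cases p; cases q; cases r) (simp add: parity_sign_add algebra_simps)

lemma twisted_mult_zero: "twisted_mult (0, 0) p = p"
  by (cases p) (simp add: parity_sign_def)

lemma exponents_append: "exponents (u @ v) = twisted_mult (exponents u) (exponents v)"
  by (induction u) (simp_all add: exponents_Nil exponents_Cons twisted_mult_assoc twisted_mult_zero)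

lemma exponents_replicate:
  "exponents (replicate k (X, b)) = (if b then int k else - int k, 0)"
  "exponents (replicate k (Y, b)) = (0, if b then int k else - int k)"
  by (induction k) (auto simp: exponents_Nil exponents_Cons parity_sign_def)

lemma same_element_refl: "same_element h p p"
  by (auto simp: same_element_def)

lemma same_element_sym:
  assumes "same_element h p q" shows "same_element h q p"
proof -
  obtain m where m: "snd p - snd q = 4 * m" "4 * h dvd fst p - fst q + 2 * h * m"
    using assms by (auto simp: same_element_def)
  have "4 * h dvd - (fst p - fst q + 2 * h * m)" using m(2) by (simp only: dvd_minus_iff)
  then have "snd q - snd p = 4 * (- m) \<and> 4 * h dvd fst q - fst p + 2 * h * (- m)"
    using m(1) by (simp add: algebra_simps)
  then show ?thesis unfolding same_element_def by blast
qed

lemma same_element_trans: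
  assumes "same_element h p q" "same_element h q r" shows "same_element h p r"
proof -
  obtain m where m: "snd p - snd q = 4 * m" "4 * h dvd fst p - fst q + 2 * h * m"
    using assms by (auto simp: same_element_def)
  obtain k where k: "snd q - snd r = 4 * k" "4 * h dvd fst q - fst r + 2 * h * k"
    using assms by (auto simp: same_element_def)
  have "snd p - snd r = 4 * (m + k) \<and> 4 * h dvd fst p - fst r + 2 * h * (m + k)"
    using m(1) k(1) dvd_add[OF m(2) k(2)] by (simp add: algebra_simps)
  then show ?thesis unfolding same_element_def by blast
qed

lemma same_element_mult:
  assumes "same_element h p p'" "same_element h q q'"
  shows "same_element h (twisted_mult p q) (twisted_mult p' q')"
proof -
  obtain i j i' j' k l k' l' where [simp]: "p = (i, j)" "p' = (i', j')" "q = (k, l)" "q' = (k', l')"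
    by (cases p; cases p'; cases q; cases q')
  obtain m where m: "j - j' = 4 * m" "4 * h dvd i - i' + 2 * h * m"
    using assms by (auto simp: same_element_def)
  obtain n where n: "l - l' = 4 * n" "4 * h dvd k - k' + 2 * h * n"
    using assms by (auto simp: same_element_def)
  have j: "j = j' + 4 * m" using m(1) by simp
  have s: "parity_sign j = parity_sign j'" by (simp add: j parity_sign_def)
  \<comment> \<open>The action of \<open>j'\<close> may negate the correction \<open>2 * h * n\<close>; the difference
      \<open>4 * h * n\<close> between the two signs is harmless.\<close>
  define e where "e = (if even j' then 0 else 1 :: int)"
  have e: "parity_sign j' = 1 - 2 * e" by (simp add: e_def parity_sign_def)
  have "(i + parity_sign j * k) - (i' + parity_sign j' * k') + 2 * h * (m + n)
      = (i - i' + 2 * h * m) + parity_sign j' * (k - k' + 2 * h * n) + 4 * h * (e * n)"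
    by (simp add: s e algebra_simps)
  also have "4 * h dvd \<dots>" by (intro dvd_add[OF dvd_add[OF m(2) dvd_mult[OF n(2)]] dvd_triv_left])
  finally have "(j + l) - (j' + l') = 4 * (m + n) \<and>
      4 * h dvd (i + parity_sign j * k) - (i' + parity_sign j' * k') + 2 * h * (m + n)"
    using m(1) n(1) by simp
  then show ?thesis by (force simp: same_element_def)
qed

text \<open>Soundness: word equality is the least congruence that contains the relations and the
  cancellations, and \<^const>\<open>same_element\<close> is such a congruence. This is what prevents the
  presented group from collapsing below order \<open>2 ^ (n + 4)\<close>.\<close>

lemma same_element_exponents:
  assumes "word_eq (G2_neg_relations (n + 2) 2 1 0) u v"
  shows "same_element (2 ^ n) (exponents u) (exponents v)"
  using assms
proof induction
  case (rel u v)
  then consider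
      "u = replicate (2 ^ (n + 2)) (X, True)" "v = []"
    | "u = replicate (2 ^ 2) (Y, True)" "v = replicate (2 ^ (n + 1)) (X, True)"
    | "u = [(Y, False), (X, True), (Y, True)]" "v = replicate (2 ^ (n + 2) - 1) (X, True)"
    by (auto simp: G2_neg_relations_def)
  then show ?case
  proof cases
    case 1
    then have "exponents u = (4 * 2 ^ n, 0)" "exponents v = (0, 0)"
      by (simp_all add: exponents_Nil exponents_replicate)
    then show ?thesis by (simp add: same_element_def)
  next
    case 2
    then have "exponents u = (0, 4)" "exponents v = (2 * 2 ^ n, 0)"
      by (simp_all add: exponents_replicate)
    then show ?thesis by (auto simp: same_element_def intro!: exI[of _ 1])
  next
    case 3
    then have "exponents u = (-1, 0)" "exponents v = (4 * 2 ^ n - 1, 0)"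
      by (simp_all add: exponents_Cons exponents_Nil exponents_replicate parity_sign_def of_nat_diff)
    then show ?thesis by (auto simp: same_element_def)
  qed
next
  case (cancel a b)
  show ?case
    by (cases a; cases b) (simp_all add: exponents_Cons exponents_Nil parity_sign_def same_element_refl)
next
  case (append u u' v v')
  then show ?case by (simp add: exponents_append same_element_mult)
qed (blast intro: same_element_refl same_element_sym same_element_trans)+

section \<open>Coordinates in the presented group\<close>

lemma (in group) inverting_conjugation:
  assumes x: "x \<in> carrier G" and y: "y \<in> carrier G" and xy: "inv y \<otimes> x \<otimes> y = inv x"
  shows "y [^] (j::int) \<otimes> x [^] (k::int) = x [^] (parity_sign j * k) \<otimes> y [^] j"
proof -
  have h1: "x [^] k \<otimes> y = y \<otimes> x [^] (- k)" for k :: int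
  proof -
    have "inv y \<otimes> x [^] k \<otimes> y = x [^] (- k)"
      using conj_int_pow[OF y x, of k] x by (simp add: xy int_pow_inv int_pow_neg)
    then show ?thesis using x y
      by (metis int_pow_closed inv_closed inv_solve_left m_assoc m_closed)
  qed
  have up: "y \<otimes> x [^] k = x [^] (- k) \<otimes> y" for k :: int
    using h1[of "-k"] by simp
  have down: "inv y \<otimes> x [^] k = x [^] (- k) \<otimes> inv y" for k :: int
    using h1[of k] x y by (metis int_pow_closed inv_closed inv_solve_left inv_solve_right m_assoc m_closed)
  show ?thesis
  proof (induction j arbitrary: k rule: int_induct[where k = 0])
    case base
    show ?case using x by (simp add: parity_sign_def)
  next
    case (step1 i)
    have "y [^] (i + 1) \<otimes> x [^] k = y [^] i \<otimes> (y \<otimes> x [^] k)"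
      using x y by (simp add: int_pow_mult m_assoc)
    also have "\<dots> = (y [^] i \<otimes> x [^] (- k)) \<otimes> y"
      using x y by (simp add: up m_assoc)
    also have "\<dots> = x [^] (parity_sign (i + 1) * k) \<otimes> y [^] (i + 1)"
      using x y step1.IH by (simp add: int_pow_mult m_assoc parity_sign_def)
    finally show ?case .
  next
    case (step2 i)
    have p: "y [^] (i - 1) = y [^] i \<otimes> inv y"
      using y by (simp add: int_pow_diff)
    have "y [^] (i - 1) \<otimes> x [^] k = y [^] i \<otimes> (inv y \<otimes> x [^] k)"
      using x y by (simp add: p m_assoc)
    also have "\<dots> = (y [^] i \<otimes> x [^] (- k)) \<otimes> inv y"
      using x y by (simp add: down m_assoc)
    also have "\<dots> = x [^] (parity_sign (i - 1) * k) \<otimes> y [^] (i - 1)"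
      using x y step2.IH by (simp add: p m_assoc parity_sign_def)
    finally show ?case .
  qed
qed

text \<open>The interface between the presentation and the count: all that matters about the
  presented group is that it is the quotient of the semidirect product by
  \<^const>\<open>same_element\<close>.\<close>

locale coordinatized_group = group G for G (structure) +
  fixes el :: "int \<times> int \<Rightarrow> 'a" and n :: nat
  assumes carrier_el: "carrier G = range el"
    and el_mult: "el p \<otimes> el q = el (twisted_mult p q)"
    and el_eq_iff: "el p = el q \<longleftrightarrow> same_element (2 ^ n) p q"

lemma exponents_surj: "\<exists>u. exponents u = p"
proof -
  obtain i j where p: "p = (i, j)" by (cases p)
  have "exponents (replicate (nat \<bar>i\<bar>) (X, i \<ge> 0) @ replicate (nat \<bar>j\<bar>) (Y, j \<ge> 0)) = (i, j)"
    by (simp add: exponents_append exponents_replicate parity_sign_def)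
  with p show ?thesis by blast
qed

lemma word_class_Cons:
  "word_class R (c # u) = word_class R [c] \<otimes>\<^bsub>presented_group R\<^esub> word_class R u"
  by (simp add: presented_group_simps)

lemma word_class_relation: "(u, v) \<in> R \<Longrightarrow> word_class R u = word_class R v"
  by (simp add: word_class_eq_iff word_eq.rel)

lemma word_class_inverse_letter:
  "word_class R [(a, False)] = inv\<^bsub>presented_group R\<^esub> word_class R [(a, True)]"
proof -
  interpret group "presented_group R" by (rule group_presented_group)
  have "word_class R [(a, False)] \<otimes>\<^bsub>presented_group R\<^esub> word_class R [(a, True)]
      = \<one>\<^bsub>presented_group R\<^esub>"
    using word_eq.cancel[of R a False] by (simp add: presented_group_simps word_class_eq_iff)
  then show ?thesis
    by (metis inv_equality presented_group_simps(1) rangeI)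
qed

lemma word_class_replicate:
  "word_class R (replicate k (a, True)) = word_class R [(a, True)] [^]\<^bsub>presented_group R\<^esub> k"
proof -
  interpret group "presented_group R" by (rule group_presented_group)
  have "word_class R [(a, True)] \<in> carrier (presented_group R)"
    by (simp add: presented_group_simps)
  then show ?thesis
  proof (induction k)
    case (Suc k)
    then show ?case
      by (simp only: replicate_Suc word_class_Cons[of R _ "replicate k _"] nat_pow_Suc2)
  qed (simp add: presented_group_simps)
qed

text \<open>The relations rewrite every word to \<open>x\<^sup>i y\<^sup>j\<close>, where \<open>(i, j)\<close>
  are its exponents, and identify pairs that are congruent. Conversely, each pair is the exponent
  pair of some word, so by soundness no further pairs are identified.\<close>

lemma G2_neg_coordinatized:
  "\<exists>el. coordinatized_group (G2_neg (n + 2) 2 1 0) el n"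
proof -
  define R where "R = G2_neg_relations (n + 2) 2 1 0"
  define G where "G = presented_group R"
  define h :: int where "h = 2 ^ n"
  interpret group G unfolding G_def by (rule group_presented_group)
  define x where "x = word_class R [(X, True)]"
  define y where "y = word_class R [(Y, True)]"
  define el where "el p = x [^]\<^bsub>G\<^esub> fst p \<otimes>\<^bsub>G\<^esub> y [^]\<^bsub>G\<^esub> snd p" for p :: "int \<times> int"
  have x: "x \<in> carrier G" and y: "y \<in> carrier G"
    by (simp_all add: x_def y_def G_def presented_group_simps)
  have "x [^]\<^bsub>G\<^esub> (2 ^ (n + 2) :: nat) = \<one>\<^bsub>G\<^esub>"
    using word_class_relation[of "replicate (2 ^ (n + 2)) (X, True)" "[]" R]
    by (simp add: R_def G2_neg_relations_def x_def G_def word_class_replicate presented_group_simps)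
  then have x_order: "x [^]\<^bsub>G\<^esub> (4 * h) = \<one>\<^bsub>G\<^esub>"
    using int_pow_int[of G x "2 ^ (n + 2)"] by (simp add: h_def)
  have "y [^]\<^bsub>G\<^esub> (4 :: nat) = x [^]\<^bsub>G\<^esub> (2 ^ (n + 1) :: nat)"
    using word_class_relation[of "replicate (2 ^ 2) (Y, True)" "replicate (2 ^ (n + 1)) (X, True)" R]
    unfolding word_class_replicate
    by (simp add: R_def G2_neg_relations_def x_def y_def G_def)
  then have y_four: "y [^]\<^bsub>G\<^esub> (4 :: int) = x [^]\<^bsub>G\<^esub> (2 * h)"
    using int_pow_int[of G x "2 ^ (n + 1)"] int_pow_int[of G y 4] by (simp add: h_def)
  have "inv\<^bsub>G\<^esub> y \<otimes>\<^bsub>G\<^esub> (x \<otimes>\<^bsub>G\<^esub> y) = x [^]\<^bsub>G\<^esub> (2 ^ (n + 2) - 1 :: nat)"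
    using word_class_relation[of "[(Y, False), (X, True), (Y, True)]" "replicate (2 ^ (n + 2) - 1) (X, True)" R]
    unfolding word_class_replicate word_class_Cons[of R _ "_ # _"] word_class_inverse_letter
    by (simp add: R_def G2_neg_relations_def x_def y_def G_def)
  also have "\<dots> = x [^]\<^bsub>G\<^esub> (4 * h - 1)"
    using int_pow_int[of G x "2 ^ (n + 2) - 1"] by (simp add: h_def of_nat_diff)
  also have "\<dots> = inv\<^bsub>G\<^esub> x"
    using x by (simp add: int_pow_diff x_order)
  finally have "inv\<^bsub>G\<^esub> y \<otimes>\<^bsub>G\<^esub> x \<otimes>\<^bsub>G\<^esub> y = inv\<^bsub>G\<^esub> x"
    using x y by (simp add: m_assoc)
  note yx = inverting_conjugation[OF x y this]
  have mult: "el p \<otimes>\<^bsub>G\<^esub> el q = el (twisted_mult p q)" for p q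
  proof -
    obtain i j k l where [simp]: "p = (i, j)" "q = (k, l)" by (cases p; cases q)
    have "el p \<otimes>\<^bsub>G\<^esub> el q = x [^]\<^bsub>G\<^esub> i \<otimes>\<^bsub>G\<^esub> (y [^]\<^bsub>G\<^esub> j \<otimes>\<^bsub>G\<^esub> x [^]\<^bsub>G\<^esub> k) \<otimes>\<^bsub>G\<^esub> y [^]\<^bsub>G\<^esub> l"
      using x y by (simp add: el_def m_assoc)
    also have "\<dots> = x [^]\<^bsub>G\<^esub> i \<otimes>\<^bsub>G\<^esub> (x [^]\<^bsub>G\<^esub> (parity_sign j * k) \<otimes>\<^bsub>G\<^esub> y [^]\<^bsub>G\<^esub> j) \<otimes>\<^bsub>G\<^esub> y [^]\<^bsub>G\<^esub> l"
      by (simp only: yx)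
    also have "\<dots> = el (twisted_mult p q)"
      using x y by (simp add: el_def m_assoc int_pow_mult)
    finally show ?thesis .
  qed
  have inverses: "word_class R [(X, False)] = inv\<^bsub>G\<^esub> x" "word_class R [(Y, False)] = inv\<^bsub>G\<^esub> y"
    by (simp_all add: x_def y_def G_def word_class_inverse_letter)
  have letter: "word_class R [(a, b)] = el (letter_exponents (a, b))" for a b
    using x y by (cases a; cases b)
      (simp_all add: el_def inverses int_pow_neg flip: x_def y_def)
  have word: "word_class R u = el (exponents u)" for u
  proof (induction u)
    case Nil
    show ?case using x y by (simp add: exponents_Nil el_def G_def presented_group_simps)
  next
    case (Cons c u)
    then show ?case
      by (cases c) (simp add: word_class_Cons[of R _ u] letter exponents_Cons mult G_def[symmetric])
  qed
  have "carrier G = range el"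
    unfolding G_def presented_group_simps using exponents_surj by (auto simp: word) (metis rangeI)
  moreover have "el p = el q \<longleftrightarrow> same_element h p q" for p q
  proof
    assume "el p = el q"
    moreover obtain u v where [simp]: "p = exponents u" "q = exponents v"
      using exponents_surj by metis
    ultimately have "word_eq R u v" by (simp add: word[symmetric] word_class_eq_iff)
    then show "same_element h p q"
      using same_element_exponents by (simp add: R_def h_def)
  next
    assume "same_element h p q"
    moreover obtain i j k l where [simp]: "p = (i, j)" "q = (k, l)" by (cases p; cases q)
    ultimately obtain m d where m: "j - l = 4 * m" "i - k + 2 * h * m = 4 * h * d"
      by (auto simp: same_element_def dvd_def)
    have "y [^]\<^bsub>G\<^esub> (4 * m) = x [^]\<^bsub>G\<^esub> (2 * h * m)"
      using x y y_four by (simp flip: int_pow_pow)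
    moreover have "x [^]\<^bsub>G\<^esub> (4 * h * d) = \<one>\<^bsub>G\<^esub>"
      using x x_order by (simp flip: int_pow_pow)
    moreover have "j = 4 * m + l" "i + 2 * h * m = k + 4 * h * d" using m by simp_all
    ultimately have "x [^]\<^bsub>G\<^esub> i \<otimes>\<^bsub>G\<^esub> y [^]\<^bsub>G\<^esub> j = x [^]\<^bsub>G\<^esub> (k + 4 * h * d) \<otimes>\<^bsub>G\<^esub> y [^]\<^bsub>G\<^esub> l"
      using x y by (metis int_pow_closed int_pow_mult m_assoc)
    then show "el p = el q"
      using x y \<open>x [^]\<^bsub>G\<^esub> (4 * h * d) = \<one>\<^bsub>G\<^esub>\<close> by (simp add: el_def int_pow_mult)
  qed
  ultimately have "coordinatized_group G el n"
    by unfold_locales (simp_all add: mult h_def)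
  then show ?thesis unfolding G_def R_def G2_neg_def by blast
qed

section \<open>Powers and conjugates in coordinates\<close>

context coordinatized_group
begin

lemma el_closed: "el p \<in> carrier G"
  by (simp add: carrier_el)

lemma el_zero: "el (0, 0) = \<one>"
  using el_mult[of "(0, 0)" "(0, 0)"] el_closed[of "(0, 0)"] by (simp add: twisted_mult_zero l_cancel_one)

lemma finite_carrier: "finite (carrier G)"
proof (rule finite_subset)
  show "carrier G \<subseteq> el ` ({0..<4 * 2 ^ n} \<times> {0..<4})"
  proof
    fix a assume "a \<in> carrier G"
    then obtain i j where a: "a = el (i, j)" by (auto simp: carrier_el)
    let ?q = "((i + 2 * 2 ^ n * (j div 4)) mod (4 * 2 ^ n), j mod 4)"
    have "j - j mod 4 = 4 * (j div 4)" by (simp add: minus_mod_eq_mult_div)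
    moreover have "(4 * 2 ^ n :: int) dvd (i + 2 * 2 ^ n * (j div 4)) - fst ?q"
      by (simp add: minus_mod_eq_mult_div)
    ultimately have "same_element (2 ^ n) (i, j) ?q"
      unfolding same_element_def by (intro exI[of _ "j div 4"]) (simp add: algebra_simps)
    then have "a = el ?q" by (simp add: a el_eq_iff)
    then show "a \<in> el ` ({0..<4 * 2 ^ n} \<times> {0..<4})" by simp
  qed
qed simp

text \<open>If \<open>j\<close> is odd, \<open>y\<^sup>j\<close> inverts \<open>x\<close>, so that
  \<open>(x\<^sup>i y\<^sup>j)\<^sup>2 = y\<^bsup>2j\<^esup>\<close> forgets \<open>i\<close>. If \<open>j\<close> is
  even, \<open>y\<^sup>j\<close> is central and both exponents are multiplied.\<close>

lemma el_power:
  "el (i, j) [^] k = el (if even j then k * i else if even k then 0 else i, k * j)"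
proof (induction k rule: int_induct[where k = 0])
  case base
  show ?case by (simp add: el_zero)
next
  case (step1 k)
  then show ?case
    by (simp add: int_pow_mult el_closed el_mult parity_sign_def algebra_simps)
next
  case (step2 k)
  have "el (i, j) [^] (k - 1) \<otimes> el (i, j) = el (i, j) [^] k"
    using int_pow_mult[OF el_closed, of "(i, j)" "k - 1" 1] by (simp add: el_closed)
  also have "\<dots> = el (if even j then (k - 1) * i else if even (k - 1) then 0 else i, (k - 1) * j)
      \<otimes> el (i, j)"
    unfolding step2.IH by (simp add: el_mult parity_sign_def algebra_simps)
  finally show ?case by (simp add: el_closed)
qed

text \<open>Multiplying through by \<open>g\<close> turns conjugacy into one congruence between integer
  pairs, without inverses.\<close>

lemma conjugate_power_iff:
  assumes "r = (i, j)"
  shows "el s = inv (el g) \<otimes> el r [^] k \<otimes> el g \<longleftrightarrow>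
    same_element (2 ^ n) (twisted_mult g s)
      (twisted_mult (if even j then k * i else if even k then 0 else i, k * j) g)"
proof -
  have "el s = inv (el g) \<otimes> el r [^] k \<otimes> el g \<longleftrightarrow> el g \<otimes> el s = el r [^] k \<otimes> el g"
    using el_closed by (metis int_pow_closed inv_closed inv_solve_left m_assoc m_closed)
  then show ?thesis by (simp only: assms el_power el_mult el_eq_iff)
qed

end

section \<open>Representatives of the maximal cyclic subgroups\<close>

text \<open>Write \<open>h = 2 ^ n\<close> and \<open>t = x\<^bsup>-h\<^esup> y\<^sup>2\<close>, an involution that commutes
  with \<open>x\<close>. The first three pairs are \<open>x\<close>, \<open>y\<close> and \<open>xy\<close>; the others
  are the elements \<open>x\<^sup>w t\<close> with \<open>w = 2 ^ v\<close>. The value \<open>v = n\<close> is left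
  out because it gives \<open>y\<^sup>2\<close>, which is not maximal, and \<open>v = n + 2\<close>, where
  \<open>x\<^sup>w t = t\<close>, because conjugation by \<open>y\<close> takes \<open>t\<close> to
  \<open>x\<^bsup>2h\<^esup> t\<close>, the case \<open>v = n + 1\<close>.\<close>

definition representatives :: "nat \<Rightarrow> (int \<times> int) set"
  where "representatives n =
    {(1, 0), (0, 1), (1, 1)} \<union> (\<lambda>v. (2 ^ v - 2 ^ n, 2)) ` ({..n + 1} - {n})"

lemma card_representatives: "card (representatives n) = n + 4"
proof -
  have "card ((\<lambda>v. (2 ^ v - 2 ^ n, 2) :: int \<times> int) ` ({..n + 1} - {n})) = n + 1"
    by (subst card_image) (auto simp: inj_on_def)
  then show ?thesis
    unfolding representatives_def by (subst card_Un_disjoint) auto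
qed

text \<open>The powers and conjugates of \<open>x\<^sup>w t\<close> outside \<open>\<langle>x\<rangle>\<close> have the
  form \<open>x\<^sup>z t\<close> with \<open>z\<close> an odd multiple of \<open>w\<close>, up to a multiple of
  \<open>2 * h\<close>. The terms other than the one with the smaller power of two are divisible by twice
  that power, so the 2-adic valuation of \<open>w\<close> is determined.\<close>

lemma power_two_valuation_unique:
  fixes s t e :: int
  assumes st: "odd s" "odd t" and uv: "u \<le> n + 1" "v \<le> n + 1"
    and dvd: "4 * 2 ^ n dvd s * 2 ^ v - t * 2 ^ u + 2 * 2 ^ n * e"
  shows "u = v"
proof -
  have absurd: False if "odd c" "a < b" "b \<le> n + 1" "4 * 2 ^ n dvd c * 2 ^ a + d * 2 ^ b + 2 * 2 ^ n * f"
    for a b and c d f :: int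
  proof -
    have "(2::int) ^ Suc a dvd 2 ^ (n + 2)" "(2::int) ^ Suc a dvd 2 ^ b" "(2::int) ^ Suc a dvd 2 ^ (n + 1)"
      by (rule le_imp_power_dvd, use that in simp)+
    then have "2 ^ Suc a dvd (c * 2 ^ a + d * 2 ^ b + 2 * 2 ^ n * f) - d * 2 ^ b - 2 ^ (n + 1) * f"
      using that(4) by (intro dvd_diff dvd_mult dvd_mult2) (auto intro: dvd_trans)
    then have "2 ^ a * 2 dvd 2 ^ a * c" by (simp add: mult.commute)
    then show False using \<open>odd c\<close> by simp
  qed
  show ?thesis
  proof (cases u v rule: linorder_cases)
    case less
    then show ?thesis using absurd[of "-t" u v s e] st uv dvd by (simp add: algebra_simps)
  next
    case greater
    then show ?thesis using absurd[of s v u "-t" e] st uv dvd by (simp add: algebra_simps)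
  qed
qed

text \<open>Conjugation preserves the second exponent modulo 4 and the parity of the first. These
  two invariants separate \<open>x\<close>, \<open>y\<close> and \<open>xy\<close> from all powers of the other
  representatives, and all \<open>x\<^sup>w t\<close> from the powers of \<open>x\<close>. The elements \<open>x\<^sup>w t\<close> are told apart by the valuation of \<open>w\<close>. The same
  argument shows that the only one of them in a conjugate of \<open>\<langle>y\<rangle>\<close> or
  \<open>\<langle>xy\<rangle>\<close> would be the omitted \<open>y\<^sup>2 = x\<^sup>h t\<close>.\<close>

lemma representatives_separated:
  assumes p: "p \<in> representatives n" "p = (i, j)" and q: "q \<in> representatives n"
    and same: "same_element (2 ^ n) (twisted_mult g q)
      (twisted_mult (if even j then k * i else if even k then 0 else i, k * j) g)"
  shows "q = p"
proof -
  obtain i' j' a b where q': "q = (i', j')" and g: "g = (a, b)" by (cases q; cases g)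
  define z where "z = (if even j then k * i else if even k then 0 else i)"
  define h :: int where "h = 2 ^ n"
  obtain m where m: "j' - k * j = 4 * m"
    and dvd: "4 * h dvd a + parity_sign b * i' - (z + parity_sign (k * j) * a) + 2 * h * m"
    using same unfolding z_def[symmetric] q' g same_element_def h_def by auto
  have s: "odd (parity_sign b)" by (simp add: parity_sign_def)
  have "even (a + parity_sign b * i' - (z + parity_sign (k * j) * a) + 2 * h * m)"
    using dvd by (rule dvd_trans[rotated]) simp
  then have parity: "even i' \<longleftrightarrow> even z"
    by (simp add: s) (auto simp: parity_sign_def split: if_splits)
  consider "p = (1, 0)" | e where "e \<in> {0, 1}" "p = (e, 1)"
    | u where "u \<le> n + 1" "p = (2 ^ u - h, 2)"
    using p(1) by (auto simp: representatives_def h_def)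
  note p_cases = this
  consider "q = (1, 0)" | e where "e \<in> {0, 1}" "q = (e, 1)"
    | v where "v \<le> n + 1" "v \<noteq> n" "q = (2 ^ v - h, 2)"
    using q by (auto simp: representatives_def h_def)
  note q_cases = this
  show ?thesis
  proof (cases rule: p_cases)
    case 1
    then have "j' = 4 * m" using m p(2) by simp
    then show ?thesis using 1 by (cases rule: q_cases) (auto simp: q', presburger+)
  next
    case p: (2 e)
    then have ij: "i = e" "j = 1" using \<open>p = (i, j)\<close> by auto
    have k: "k = j' - 4 * m" using m ij by simp
    show ?thesis
    proof (cases rule: q_cases)
      case 1
      then show ?thesis using parity k by (simp add: z_def ij q')
    next
      case (2 e')
      then show ?thesis using parity k p by (auto simp: z_def ij q')
    next
      case (3 v)
      then have i': "i' = 2 ^ v - h" by (simp add: q')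
      from 3 have "z = 0" "parity_sign (k * j) = 1" using k by (auto simp: z_def ij q' parity_sign_def)
      then have "4 * 2 ^ n dvd parity_sign b * 2 ^ v - parity_sign b * 2 ^ n + 2 * 2 ^ n * m"
        using dvd by (simp add: i' h_def algebra_simps)
      then have "n = v" using 3 s by (intro power_two_valuation_unique[of "parity_sign b" "parity_sign b"]) auto
      with 3 show ?thesis by simp
    qed
  next
    case p: (3 u)
    then have ij: "i = 2 ^ u - h" "j = 2" using \<open>p = (i, j)\<close> by auto
    have z: "z = k * (2 ^ u - h)" "parity_sign (k * j) = 1" by (simp_all add: z_def ij parity_sign_def)
    show ?thesis
    proof (cases rule: q_cases)
      case 1
      then have "k = - 2 * m" using m ij by (simp add: q')
      then show ?thesis using parity 1 by (simp add: z q')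
    next
      case (2 e')
      then have "2 * k + 4 * m = 1" using m ij by (simp add: q')
      then have False by presburger
      then show ?thesis ..
    next
      case (3 v)
      then have k: "k = 1 - 2 * m" using m ij by (simp add: q')
      \<comment> \<open>If \<open>b\<close> is odd, conjugation takes \<open>x\<^sup>w t\<close> to
          \<open>x\<^bsup>2h-w\<^esup> t\<close>; \<open>e\<close> records this shift by \<open>2 * h\<close>.\<close>
      define e where "e = (if even b then 0 else 1 :: int)"
      have e: "parity_sign b = 1 - 2 * e" by (simp add: e_def parity_sign_def)
      have "a + parity_sign b * i' - (z + parity_sign (k * j) * a) + 2 * h * m
          = parity_sign b * 2 ^ v - k * 2 ^ u + 2 * h * e"
        using 3 by (simp add: q' z) (simp add: k e algebra_simps)
      then have "4 * 2 ^ n dvd parity_sign b * 2 ^ v - k * 2 ^ u + 2 * 2 ^ n * e"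
        using dvd by (simp only: h_def)
      then have "u = v"
        using 3 p s k by (intro power_two_valuation_unique[of "parity_sign b" k]) auto
      with 3 p show ?thesis by simp
    qed
  qed
qed

text \<open>For odd \<open>j\<close>, conjugation by a power of \<open>x\<close> shifts \<open>i\<close> by any even
  number, so \<open>x\<^sup>i y\<^sup>j\<close> is conjugate to an odd power of \<open>y\<close> or
  \<open>xy\<close>. For \<open>j\<close> divisible by 4 the element is a power of \<open>x\<close>. In the remaining
  case it is \<open>x\<^sup>w t\<close> for some \<open>w\<close>, and
  \<open>(x\<^sup>w t)\<^sup>k = x\<^bsup>kw\<^esup> t\<close> for odd \<open>k\<close> reduces \<open>w\<close> to a
  power of two.\<close>

lemma representatives_cover:
  "\<exists>i j g k. (i, j) \<in> representatives n \<and> same_element (2 ^ n) (twisted_mult g s)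
    (twisted_mult (if even j then k * i else if even k then 0 else i, k * j) g)"
    (is "\<exists>i j g k. ?P i j g k")
proof -
  define h :: int where "h = 2 ^ n"
  obtain i j where s: "s = (i, j)" by (cases s)
  consider "odd j" | c where "j = 4 * c" | c where "j = 4 * c + 2"
  proof -
    have "odd j \<or> j = 4 * (j div 4) \<or> j = 4 * (j div 4) + 2" by presburger
    then show ?thesis using that by blast
  qed
  then show ?thesis
  proof cases
    case 1
    have "i = 2 * (i div 2) + i mod 2" "i mod 2 \<in> {0, 1}" by auto
    then obtain a e where "i = 2 * a + e" "e \<in> {0, 1}" by (rule that)
    then have "?P e 1 (- a, 0) j"
      using 1 by (auto simp: s representatives_def parity_sign_def same_element_def)
    then show ?thesis by blast
  next
    case 2
    have "?P 1 0 (0, 0) (i + 2 * h * c)"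
      using 2 by (auto simp: s representatives_def parity_sign_def same_element_def h_def)
    then show ?thesis by blast
  next
    case 3
    \<comment> \<open>The exponent with \<open>x\<^sup>i y\<^sup>j = x\<^sup>w t\<close>.\<close>
    define w where "w = i + 2 * h * c + h"
    consider "4 * h dvd w" | d where "w = h * (2 * d + 1)"
      | v d where "v \<in> {..n + 1} - {n}" "w = 2 ^ v * (2 * d + 1)"
    proof (cases "w = 0")
      case False
      then obtain y where y: "w = 2 ^ multiplicity 2 w * y" "odd y"
        using multiplicity_decompose'[of w 2] by auto
      let ?v = "multiplicity 2 w"
      from y(2) obtain d where d: "y = 2 * d + 1" by (elim oddE)
      consider "?v = n" | "n + 2 \<le> ?v" | "?v \<in> {..n + 1} - {n}" by force
      then show ?thesis
      proof cases
        case 2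
        then have "(2::int) ^ (n + 2) dvd w"
          by (metis dvd_mult2 le_imp_power_dvd y(1))
        then show ?thesis using that(1) by (simp add: h_def)
      qed (use that(2,3) y d in \<open>auto simp: h_def\<close>)
    qed (use that(1) in simp)
    then show ?thesis
    proof cases
      case 1
      \<comment> \<open>Here the element is \<open>t\<close>, the conjugate of \<open>x\<^bsup>2h\<^esup> t\<close> by \<open>y\<close>.\<close>
      have "4 * h dvd (- i) - h + 2 * h * c"
      proof -
        have "(- i) - h + 2 * h * c = 4 * h * c - w" by (simp add: w_def)
        then show ?thesis using 1 by simp
      qed
      moreover have "(2 ^ (n + 1) - 2 ^ n, 2) \<in> representatives n"
        unfolding representatives_def by (intro UnI2 image_eqI[of _ _ "n + 1"]) auto
      ultimately have "?P (2 ^ (n + 1) - 2 ^ n) 2 (0, 1) 1"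
        using 3 by (auto simp: s parity_sign_def same_element_def h_def)
      then show ?thesis by blast
    next
      case (2 d)
      \<comment> \<open>Here \<open>w\<close> has the omitted valuation, and the element is an odd power of \<open>y\<^sup>2\<close>.\<close>
      then have "i = 2 * h * (d - c)" by (simp add: w_def algebra_simps)
      then have "?P 0 1 (0, 0) (4 * d + 2)"
        using 3 by (auto simp: s representatives_def parity_sign_def same_element_def h_def
            intro!: exI[of _ "c - d"] simp: algebra_simps)
      then show ?thesis by blast
    next
      case (3 v d)
      then have "i - (2 * d + 1) * (2 ^ v - h) + 2 * h * (c - d) = 0"
        by (simp add: w_def algebra_simps)
      then have "?P (2 ^ v - 2 ^ n) 2 (0, 0) (2 * d + 1)"
        using \<open>j = 4 * c + 2\<close> 3(1)
        by (auto simp: s representatives_def parity_sign_def same_element_def h_def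
            intro!: exI[of _ "c - d"])
      then show ?thesis by blast
    qed
  qed
qed

lemma (in coordinatized_group) eta_eq: "eta G = n + 4"
proof -
  have "eta G = card (el ` representatives n)"
  proof (rule eta_eq_card_transversal)
    fix a assume "a \<in> carrier G"
    then obtain s where a: "a = el s" by (auto simp: carrier_el)
    obtain i j g k where "(i, j) \<in> representatives n" "a = inv (el g) \<otimes> el (i, j) [^] (k::int) \<otimes> el g"
      unfolding a conjugate_power_iff[OF HOL.refl] using representatives_cover by blast
    then show "\<exists>r\<in>el ` representatives n. \<exists>g\<in>carrier G. \<exists>k::int. a = inv g \<otimes> r [^] k \<otimes> g"
      using el_closed by blast
  next
    fix r s g and k :: int
    assume r: "r \<in> el ` representatives n" and s: "s \<in> el ` representatives n"
      and "g \<in> carrier G" and eq: "s = inv g \<otimes> r [^] k \<otimes> g"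
    then obtain p q c where pq: "p \<in> representatives n" "r = el p" "q \<in> representatives n" "s = el q"
      "g = el c" by (auto simp: carrier_el)
    obtain i j where p: "p = (i, j)" by (cases p)
    have "q = p"
      using eq representatives_separated[OF pq(1) p pq(3)] unfolding pq conjugate_power_iff[OF p] by blast
    then show "s = r" by (simp add: pq)
  qed (use finite_carrier el_closed in auto)
  also have "\<dots> = card (representatives n)"
  proof (intro card_image inj_onI)
    fix p q assume pq: "p \<in> representatives n" "q \<in> representatives n" "el p = el q"
    obtain i j where p: "p = (i, j)" by (cases p)
    have "el q = inv (el (0, 0)) \<otimes> el p [^] (1::int) \<otimes> el (0, 0)"
      using pq(3) el_closed by (simp add: el_zero)
    then show "p = q"
      using representatives_separated[OF pq(1) p pq(2)] unfolding conjugate_power_iff[OF p] by blast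
  qed
  finally show ?thesis by (simp add: card_representatives)
qed

theorem lemma4p6:
  fixes \<alpha> :: nat
  assumes "neg_type_params \<alpha> 2 1 0"
  shows "eta (G2_neg \<alpha> 2 1 0) = \<alpha> + 2"
proof -
  from assms have "\<alpha> \<ge> 2" by (simp add: neg_type_params_def)
  then obtain n where \<alpha>: "\<alpha> = n + 2" using nat_le_iff_add by (metis add.commute)
  obtain el where "coordinatized_group (G2_neg \<alpha> 2 1 0) el n"
    using G2_neg_coordinatized \<alpha> by blast
  then show ?thesis by (simp add: coordinatized_group.eta_eq \<alpha>)
qed

end
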